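(* Let $n,m$ be integers with $n\ge 2$ and $n\le m\le \lfloor n/2\rfloor\lceil n/2\rceil$. Let $$k_0=\max\{k : \lceil n/2\rceil\le k\le n-q-\mathrm{sgn}(r),\ \text{where } m=qk+r,\ 0\le r<k\}.$$ Suppose $B^\ast$ is a bipartite graph with $n$ vertices and $m$ edges such that $\sigma_2(B^\ast)$ attains the maximum value of $\sigma_2$ among all bipartite graphs with $n$ vertices and $m$ edges. Then: (a) if $m>(n-k_0)(k_0-1)$, then $B^\ast\cong B^l(n,m,k_0)$ or $B^\ast\cong B^l(n,m,n-k_0)$; (b) if $m=(n-k_0)(k_0-1)$, then $B^\ast\cong B^l(n,m,k_0)$, $B^\ast\cong B^l(n,m,n-k_0)$, or $B^\ast\cong B^l(n,m,k_0-1)$; (c) if $m<(n-k_0)(k_0-1)$, then $B^\ast\cong B^l(n,m,k_0)$.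
   Context: All graphs are finite, simple and undirected. For a graph $G$, $\sigma_2(G)=\sum_{v\in V(G)} d(v)^2$, where $d(v)$ is the degree of $v$. $\mathrm{sgn}(x)$ is $1,-1,0$ according as $x$ is positive, negative, zero. For integers $n\ge2$, $0\le m\le\lfloor n/2\rfloor\lceil n/2\rceil$, $1\le k\le n-1$, write $m=qk+r$ with $0\le r<k$; then $B^l(n,m,k)$ denotes the bipartite graph with $n$ vertices and $m$ edges and bipartition $(X,Y)$, $|X|=k$, $|Y|=n-k$, in which $q$ vertices of $Y$ are adjacent to all vertices of $X$, one further vertex of $Y$ is adjacent to exactly $r$ vertices of $X$ if $r>0$, and there are no other edges. *)

theory Defs
  imports Main
begin

record 'a ugraph =
  verts :: "'a set"
  edges :: "'a set set"

definition simple_graph :: "'a ugraph \<Rightarrow> bool" where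
  "simple_graph G \<longleftrightarrow> finite (verts G) \<and> (\<forall>e\<in>edges G. e \<subseteq> verts G \<and> card e = 2)"

definition degree :: "'a ugraph \<Rightarrow> 'a \<Rightarrow> nat" where
  "degree G v = card {e \<in> edges G. v \<in> e}"

definition sigma2 :: "'a ugraph \<Rightarrow> nat" where
  "sigma2 G = (\<Sum>v\<in>verts G. (degree G v)\<^sup>2)"

definition bipartition :: "'a ugraph \<Rightarrow> 'a set \<Rightarrow> 'a set \<Rightarrow> bool" where
  "bipartition G X Y \<longleftrightarrow> X \<union> Y = verts G \<and> X \<inter> Y = {} \<and>
     (\<forall>e\<in>edges G. \<exists>x\<in>X. \<exists>y\<in>Y. e = {x, y})"

definition bipartite :: "'a ugraph \<Rightarrow> bool" where
  "bipartite G \<longleftrightarrow> (\<exists>X Y. bipartition G X Y)"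

definition bipartite_graphs :: "nat \<Rightarrow> nat \<Rightarrow> 'a ugraph set" where
  "bipartite_graphs n m =
     {G. simple_graph G \<and> bipartite G \<and> card (verts G) = n \<and> card (edges G) = m}"

definition graph_iso :: "'a ugraph \<Rightarrow> 'b ugraph \<Rightarrow> bool" (infix "\<simeq>" 50) where
  "G \<simeq> H \<longleftrightarrow> (\<exists>f. bij_betw f (verts G) (verts H) \<and>
     (\<forall>u\<in>verts G. \<forall>v\<in>verts G. {u, v} \<in> edges G \<longleftrightarrow> {f u, f v} \<in> edges H))"

text \<open>
  A concrete model of \<open>B\<^sup>l(n,m,k)\<close>: the part \<open>X\<close> consists of the vertices \<open>Inl i\<close> with \<open>i < k\<close>,
  the part \<open>Y\<close> of the vertices \<open>Inr j\<close> with \<open>j < n - k\<close>.  It has \<open>m\<close> edges only if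
  \<open>m \<le> k * (n - k)\<close>, i.e. if \<open>Y\<close> is large enough for the description to make sense.
\<close>

definition Bl :: "nat \<Rightarrow> nat \<Rightarrow> nat \<Rightarrow> (nat + nat) ugraph" where
  "Bl n m k = (let q = m div k; r = m mod k in
     \<lparr> verts = Inl ` {..<k} \<union> Inr ` {..<n - k},
       edges = {{Inl i, Inr j} | i j. i < k \<and> j < n - k \<and> (j < q \<or> (j = q \<and> i < r))} \<rparr>)"

definition k0 :: "nat \<Rightarrow> nat \<Rightarrow> nat" where
  "k0 n m = Max {k. (n + 1) div 2 \<le> k \<and>
                    int k \<le> int n - int (m div k) - sgn (int (m mod k))}"

lemma Bl_simple_graph: "simple_graph (Bl n m k)"
  by (auto simp: simple_graph_def Bl_def Let_def)

lemma Bl_bipartition: "bipartition (Bl n m k) (Inl ` {..<k}) (Inr ` {..<n - k})"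
  unfolding bipartition_def Bl_def Let_def by fastforce

lemma Bl_in_bipartite_graphs:
  assumes "0 < k" "k \<le> n" "m \<le> k * (n - k)"
  shows "Bl n m k \<in> bipartite_graphs n m"
proof -
  have v: "card (verts (Bl n m k)) = n"
  proof -
    have "card (Inl ` {..<k} \<union> Inr ` {..<n - k} :: (nat + nat) set) = k + (n - k)"
      by (subst card_Un_disjoint) (auto simp: card_image)
    then show ?thesis using assms(2) by (simp add: Bl_def Let_def)
  qed
  have lt: "j < m div k \<or> (j = m div k \<and> i < m mod k) \<longleftrightarrow> j * k + i < m" if "i < k" for i j
  proof -
    have "j * k + i < m \<longleftrightarrow> j * k + i < (m div k) * k + m mod k" by simp
    also have "\<dots> \<longleftrightarrow> j < m div k \<or> (j = m div k \<and> i < m mod k)"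
    proof (cases j "m div k" rule: linorder_cases)
      case less
      then have "Suc j * k \<le> (m div k) * k" by (intro mult_le_mono1) simp
      then have "j * k + i < (m div k) * k + m mod k"
        using that by (simp only: mult_Suc)
      then show ?thesis using less by blast
    next
      case greater
      then have "Suc (m div k) * k \<le> j * k" by (intro mult_le_mono1) simp
      moreover have "m mod k < k" using assms(1) by simp
      ultimately have "\<not> j * k + i < (m div k) * k + m mod k"
        by (simp only: mult_Suc)
      then show ?thesis using greater by auto
    next
      case equal
      then show ?thesis by (simp only: add_less_cancel_left) blast
    qed
    finally show ?thesis ..
  qed
  let ?f = "\<lambda>t. {Inl (t mod k), Inr (t div k)} :: (nat + nat) set"
  have "edges (Bl n m k) = ?f ` {..<m}"
  proof (intro equalityI subsetI)
    fix e assume "e \<in> edges (Bl n m k)"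
    then obtain i j where "e = {Inl i, Inr j}" "i < k" "j * k + i < m"
      unfolding Bl_def Let_def using lt by auto
    then show "e \<in> ?f ` {..<m}" by (intro image_eqI[of _ _ "j * k + i"]) auto
  next
    fix e assume "e \<in> ?f ` {..<m}"
    then obtain t where t: "t < m" "e = ?f t" by auto
    have "t mod k < k" using assms(1) by simp
    moreover have "t div k < n - k"
      using t(1) assms by (simp add: less_mult_imp_div_less mult.commute)
    moreover have "t div k * k + t mod k < m" using t(1) by simp
    ultimately show "e \<in> edges (Bl n m k)"
      unfolding Bl_def Let_def using lt[of "t mod k" "t div k"] t(2) by auto
  qed
  moreover have "inj_on ?f {..<m}"
  proof (rule inj_onI)
    fix s t assume "?f s = ?f t"
    then have "s mod k = t mod k" "s div k = t div k" by (auto simp: doubleton_eq_iff)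
    then show "s = t" by (metis div_mult_mod_eq)
  qed
  ultimately have "card (edges (Bl n m k)) = m" by (simp add: card_image)
  then show ?thesis
    using v Bl_simple_graph Bl_bipartition unfolding bipartite_graphs_def bipartite_def by blast
qed

lemma k0_set:
  assumes "n \<ge> 2" "m \<le> n div 2 * ((n + 1) div 2)"
  defines "K \<equiv> {k. (n + 1) div 2 \<le> k \<and> int k \<le> int n - int (m div k) - sgn (int (m mod k))}"
  shows "finite K" and "(n + 1) div 2 \<in> K"
proof -
  have "k \<le> n" if "k \<in> K" for k
  proof -
    have "0 \<le> sgn (int (m mod k))" by (simp add: sgn_if)
    then show ?thesis using that unfolding K_def mem_Collect_eq by linarith
  qed
  then show "finite K" by (meson atMost_iff finite_atMost finite_subset subsetI)
next
  let ?k = "(n + 1) div 2"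
  have n: "n = n div 2 + ?k" and k: "?k > 0" using assms(1) by presburger+
  have "m div ?k + (if m mod ?k = 0 then 0 else 1) \<le> n div 2"
  proof (cases "m mod ?k = 0")
    case True
    have "m div ?k \<le> (n div 2 * ?k) div ?k" by (rule div_le_mono[OF assms(2)])
    then show ?thesis using True k by simp
  next
    case False
    then have "m \<noteq> n div 2 * ?k" by (metis mod_mult_self2_is_0)
    then have "m < n div 2 * ?k" using assms(2) by simp
    then show ?thesis using False by (simp add: less_mult_imp_div_less Suc_leI)
  qed
  then show "?k \<in> K" using n unfolding K_def by (auto simp: sgn_if split: if_splits)
qed

end

theory Submission
  imports Defs
begin

text \<open>
  View a bipartite graph as a relation \<open>R \<subseteq> X \<times> Y\<close>. A shifting argument shows that in an extremal
  graph the neighbourhoods are nested. For nested \<open>R\<close>, a vertex \<open>y\<close> of maximal degree \<open>c\<close> sees every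
  non-isolated vertex of \<open>X\<close>, so deleting it lowers \<open>\<sigma>\<^sub>2\<close> by an amount depending only on \<open>c\<close> and \<open>m\<close>.
  Induction on \<open>|Y|\<close>, together with the monotonicity in \<open>a\<close> of the value \<open>fillval a m\<close> of
  \<open>B\<^sup>l(n,m,a)\<close>, gives \<open>\<sigma>\<^sub>2 \<le> fillval a m\<close> whenever \<open>|Y| \<le> a\<close> and \<open>|X| \<le> a\<close>. If \<open>|Y| \<le> |X|\<close>,
  then \<open>|X| \<le> k\<^sub>0\<close>, because \<open>k\<^sub>0\<close> is the largest \<open>k\<close> with \<open>m \<le> k (n - k)\<close>; hence the extremal value is
  \<open>fillval k\<^sub>0 m\<close>. The same induction determines the equality case in a box with
  \<open>|X| (|Y| - 1) \<le> m\<close>, and equality of consecutive values \<open>fillval a m\<close> leaves only \<open>|X| = k\<^sub>0\<close>, or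
  \<open>|X| = k\<^sub>0 - 1\<close> with \<open>m = (n - k\<^sub>0) (k\<^sub>0 - 1)\<close>.
\<close>

section \<open>The extremal value\<close>

text \<open>
  With \<open>m = q a + r\<close> this is \<open>\<sigma>\<^sub>2(B\<^sup>l(n,m,a)) = q a\<^sup>2 + r\<^sup>2 + r (q + 1)\<^sup>2 + (a - r) q\<^sup>2\<close>, expanded so
  that no subtraction occurs.
\<close>

definition fillval :: "nat \<Rightarrow> nat \<Rightarrow> nat" where
  "fillval a m = (let q = m div a; r = m mod a in q * a\<^sup>2 + a * q\<^sup>2 + 2 * q * r + r\<^sup>2 + r)"

lemma fillval_eq:
  "r < a \<Longrightarrow> fillval a (q * a + r) = q * a\<^sup>2 + a * q\<^sup>2 + 2 * q * r + r\<^sup>2 + r"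
  by (simp add: fillval_def Let_def)

text \<open>One more full vertex raises the quotient and keeps the remainder. The increment has the
  same form as the loss in \<open>dsq_remove_dominating\<close> for \<open>card C = a\<close>, so
  deletion arguments carry over to \<open>fillval\<close>.\<close>

lemma fillval_add:
  assumes "a > 0"
  shows "fillval a (a + m) = a\<^sup>2 + a + 2 * m + fillval a m"
proof -
  obtain q r where m: "m = q * a + r" and r: "r < a"
    using assms by (metis div_mult_mod_eq mod_less_divisor)
  have "fillval a (a + m) = fillval a (Suc q * a + r)" using m by (simp add: add.assoc)
  also have "\<dots> = a\<^sup>2 + a + 2 * m + fillval a m"
    unfolding m fillval_eq[OF r] by (simp add: power2_eq_square algebra_simps)
  finally show ?thesis .
qed

text \<open>Write \<open>m = q c + r\<close> and divide by \<open>c + 1\<close> instead: the value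
  grows by \<open>2 q (c - r)\<close> if \<open>q \<le> r\<close>, and by \<open>2 r (c - q)\<close>
  otherwise. Since \<open>r < c\<close>, the growth vanishes only for \<open>q = 0\<close>,
  \<open>r = 0\<close> or \<open>q = c\<close>.\<close>

lemma fillval_Suc:
  assumes "c > 0" "m \<le> c * (c + 1)"
  shows "fillval c m \<le> fillval (Suc c) m"
    and "fillval c m = fillval (Suc c) m \<Longrightarrow> m < c \<or> c dvd m \<or> m div c = c"
proof -
  define q r where "q = m div c" and "r = m mod c"
  have m: "m = q * c + r" and r: "r < c" using assms(1) by (auto simp: q_def r_def)
  have "fillval c m \<le> fillval (Suc c) m \<and>
    (fillval c m = fillval (Suc c) m \<longrightarrow> q = 0 \<or> r = 0 \<or> q = c)"
  proof (cases "q \<le> r")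
    case True
    then obtain s where s: "r = q + s" using le_Suc_ex by blast
    obtain d where d: "c = q + s + Suc d" using r s less_imp_Suc_add by (metis add_Suc_right)
    have "m = q * Suc c + s" using m s by simp
    then have "fillval (Suc c) m = q * (Suc c)\<^sup>2 + Suc c * q\<^sup>2 + 2 * q * s + s\<^sup>2 + s"
      using fillval_eq[of s "Suc c" q] r s by simp
    moreover have "fillval c m = q * c\<^sup>2 + c * q\<^sup>2 + 2 * q * r + r\<^sup>2 + r"
      using fillval_eq[OF r] m by simp
    ultimately have "fillval (Suc c) m = fillval c m + 2 * q * Suc d"
      unfolding s d by (simp add: power2_eq_square algebra_simps)
    then show ?thesis by auto
  next
    case False
    then obtain t where t: "q = r + Suc t" using less_imp_Suc_add by (metis add_Suc_right not_le)
    \<comment> \<open>The bound on \<open>m\<close> enters here: it keeps \<open>2 r (c - q)\<close>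
      from becoming negative.\<close>
    have qc: "q \<le> c \<or> q = Suc c \<and> r = 0"
    proof (rule ccontr)
      assume *: "\<not> ?thesis"
      then have "Suc c \<le> q" by simp
      then have "Suc c * c \<le> q * c" by (rule mult_le_mono1)
      then have "q * c \<le> Suc c * c" "r = 0" using m assms(2) by (auto simp: algebra_simps)
      then have "q \<le> Suc c" using assms(1) mult_le_cancel2 by blast
      with * \<open>r = 0\<close> \<open>Suc c \<le> q\<close> show False by simp
    qed
    then have "t \<le> c" using t by auto
    then obtain u where u: "c = t + u" using le_Suc_ex by blast
    \<comment> \<open>When \<open>r < q\<close> the quotient by \<open>Suc c\<close> drops to
      \<open>q - 1 = r + t\<close>, with remainder \<open>u\<close>.\<close>
    have "m = (r + t) * Suc c + u" using m t u by (simp add: algebra_simps)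
    then have "fillval (Suc c) m
        = (r + t) * (Suc c)\<^sup>2 + Suc c * (r + t)\<^sup>2 + 2 * (r + t) * u + u\<^sup>2 + u"
      using fillval_eq[of u "Suc c" "r + t"] u by simp
    moreover have "fillval c m = q * c\<^sup>2 + c * q\<^sup>2 + 2 * q * r + r\<^sup>2 + r"
      using fillval_eq[OF r] m by simp
    ultimately have *: "fillval (Suc c) m + 2 * r * q = fillval c m + 2 * r * c"
      unfolding t u by (simp add: power2_eq_square algebra_simps)
    show ?thesis
    proof (cases "r = 0")
      case False
      then have "q \<le> c" using qc by simp
      then have "2 * r * q \<le> 2 * r * c" by simp
      moreover have "q = c" if "2 * r * q = 2 * r * c" using that False by simp
      ultimately show ?thesis using * by linarith
    qed (use * in simp)
  qed
  moreover have "m < c" if "q = 0" using that r m by simp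
  moreover have "c dvd m" if "r = 0" using that m by simp
  ultimately show "fillval c m \<le> fillval (Suc c) m"
    "fillval c m = fillval (Suc c) m \<Longrightarrow> m < c \<or> c dvd m \<or> m div c = c"
    unfolding q_def by auto
qed

lemma fillval_mono:
  assumes "c > 0" "m \<le> c * (c + 1)" "c \<le> a"
  shows "fillval c m \<le> fillval a m"
  using assms(3)
proof (induction a rule: dec_induct)
  case (step k)
  have "c * (c + 1) \<le> k * (k + 1)" using step.hyps by (intro mult_le_mono) auto
  then have "fillval k m \<le> fillval (Suc k) m"
    using step.hyps assms by (intro fillval_Suc) auto
  then show ?case using step.IH by simp
qed simp

section \<open>Sums of squared degrees of nested relations\<close>

text \<open>Summing over \<open>Domain\<close> and \<open>Range\<close> makes the value independent
  of the ambient parts, so inductions may shrink them freely; isolated vertices would contribute 0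
  anyway.\<close>

definition dsq :: "('a \<times> 'a) set \<Rightarrow> nat" where
  "dsq R = (\<Sum>x\<in>Domain R. (card (R `` {x}))\<^sup>2) + (\<Sum>y\<in>Range R. (card (R\<inverse> `` {y}))\<^sup>2)"

lemma dsq_converse [simp]: "dsq (R\<inverse>) = dsq R"
  by (simp add: dsq_def)

lemma dsq_superset:
  assumes "finite X" "finite Y" "R \<subseteq> X \<times> Y"
  shows "dsq R = (\<Sum>x\<in>X. (card (R `` {x}))\<^sup>2) + (\<Sum>y\<in>Y. (card (R\<inverse> `` {y}))\<^sup>2)"
proof -
  have "(\<Sum>x\<in>Domain R. (card (R `` {x}))\<^sup>2) = (\<Sum>x\<in>X. (card (R `` {x}))\<^sup>2)"
  proof (rule sum.mono_neutral_left)
    show "\<forall>x\<in>X - Domain R. (card (R `` {x}))\<^sup>2 = 0"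
      by (metis DiffD2 Image_singleton_iff DomainI card.empty equals0I power_zero_numeral)
  qed (use assms in auto)
  moreover have "(\<Sum>y\<in>Range R. (card (R\<inverse> `` {y}))\<^sup>2) = (\<Sum>y\<in>Y. (card (R\<inverse> `` {y}))\<^sup>2)"
  proof (rule sum.mono_neutral_left)
    have "R\<inverse> `` {y} = {}" if "y \<notin> Range R" for y using that by blast
    then show "\<forall>y\<in>Y - Range R. (card (R\<inverse> `` {y}))\<^sup>2 = 0" by simp
  qed (use assms in auto)
  ultimately show ?thesis by (simp add: dsq_def)
qed

lemma card_eq_sum_Image:
  assumes "finite X" "finite Y" "R \<subseteq> X \<times> Y"
  shows "card R = (\<Sum>x\<in>X. card (R `` {x}))"
proof -
  have "R = Sigma X (\<lambda>x. R `` {x})" using assms(3) by auto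
  moreover have "finite (R `` {x})" for x
    using assms(2,3) by (auto intro: finite_subset[of _ Y])
  ultimately show ?thesis using assms(1) by (metis card_SigmaI)
qed

text \<open>All non-isolated vertices on the left lie in \<open>C\<close>, and each loses exactly
  one neighbour. By \<open>(d + 1)\<^sup>2 = d\<^sup>2 + 2 d + 1\<close> the loss depends only on
  \<open>card C\<close> and on the number of remaining edges.\<close>

lemma dsq_remove_dominating:
  assumes R: "finite R" and dom: "\<And>z. R\<inverse> `` {z} \<subseteq> C" and C: "C = R\<inverse> `` {y}"
  defines "R' \<equiv> R - C \<times> {y}"
  shows "dsq R = (card C)\<^sup>2 + card C + 2 * card R' + dsq R'"
    and "card R = card C + card R'"
    and "R' \<subseteq> C \<times> (Range R - {y})"
proof -
  \<comment> \<open>\<open>y\<close> may lie outside \<open>Range R\<close>: \<open>C\<close> can be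
    empty, as in \<open>ex_dsq_eq_fillval\<close> for \<open>m = 0\<close>.\<close>
  let ?Y = "insert y (Range R)"
  have fin: "finite C" "finite ?Y"
    using R C finite_Range by (auto simp: finite_Domain intro: finite_subset[of _ "Domain R"])
  have sub: "R \<subseteq> C \<times> ?Y" using dom by auto
  show sub': "R' \<subseteq> C \<times> (Range R - {y})" using sub C by (auto simp: R'_def)
  have sub2: "R' \<subseteq> C \<times> ?Y" using sub' by auto
  have "R = C \<times> {y} \<union> R'" "C \<times> {y} \<inter> R' = {}" using C by (auto simp: R'_def)
  moreover have "finite R'" using R by (simp add: R'_def)
  ultimately have "card R = card (C \<times> {y}) + card R'"
    using fin by (metis card_Un_disjoint finite_SigmaI finite.emptyI finite.insertI)
  then show "card R = card C + card R'" by (simp add: card_cartesian_product)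
  have deg: "card (R `` {x}) = Suc (card (R' `` {x}))" if "x \<in> C" for x
  proof -
    have "R `` {x} = insert y (R' `` {x})" "y \<notin> R' `` {x}"
      using that C by (auto simp: R'_def)
    moreover have "finite (R' `` {x})" using \<open>finite R'\<close> by simp
    ultimately show ?thesis by simp
  qed
  have "(\<Sum>x\<in>C. (card (R `` {x}))\<^sup>2)
      = (\<Sum>x\<in>C. (card (R' `` {x}))\<^sup>2 + 2 * card (R' `` {x}) + 1)"
    by (intro sum.cong) (auto simp: deg power2_eq_square)
  also have "\<dots> = (\<Sum>x\<in>C. (card (R' `` {x}))\<^sup>2) + 2 * card R' + card C"
    using card_eq_sum_Image[OF fin sub2] by (simp add: sum.distrib sum_distrib_left sum_Suc)
  finally have A: "(\<Sum>x\<in>C. (card (R `` {x}))\<^sup>2)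
      = (\<Sum>x\<in>C. (card (R' `` {x}))\<^sup>2) + 2 * card R' + card C" .
  have "R'\<inverse> `` {y} = {}" using C by (auto simp: R'_def)
  moreover have "R'\<inverse> `` {z} = R\<inverse> `` {z}" if "z \<noteq> y" for z using that by (auto simp: R'_def)
  moreover from this have "(\<Sum>z\<in>?Y - {y}. (card (R'\<inverse> `` {z}))\<^sup>2)
      = (\<Sum>z\<in>?Y - {y}. (card (R\<inverse> `` {z}))\<^sup>2)" by (intro sum.cong) auto
  ultimately have "(\<Sum>z\<in>?Y. (card (R\<inverse> `` {z}))\<^sup>2) = (card C)\<^sup>2 + (\<Sum>z\<in>?Y. (card (R'\<inverse> `` {z}))\<^sup>2)"
    using fin C by (simp add: sum.remove[of ?Y y])
  with A show "dsq R = (card C)\<^sup>2 + card C + 2 * card R' + dsq R'"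
    unfolding dsq_superset[OF fin sub] dsq_superset[OF fin sub2] by simp
qed

text \<open>
  The bipartite graph contains no induced \<open>2K\<^sub>2\<close>; this form of nestedness is visibly symmetric in
  the two parts.
\<close>

definition nested :: "('a \<times> 'a) set \<Rightarrow> bool" where
  "nested R \<longleftrightarrow> (\<forall>x y x' y'. (x, y) \<in> R \<longrightarrow> (x', y') \<in> R \<longrightarrow> (x, y') \<in> R \<or> (x', y) \<in> R)"

lemma nested_converse: "nested R \<Longrightarrow> nested (R\<inverse>)"
  unfolding nested_def by (metis converse_iff)

lemma nested_remove: "nested R \<Longrightarrow> nested (R - (R\<inverse> `` {y}) \<times> {y})"
  unfolding nested_def by auto

text \<open>Neighbourhoods in a nested relation form a chain under inclusion, so one of maximal
  cardinality contains all others.\<close>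

lemma nested_dominating:
  assumes "nested R" "finite R" "R \<noteq> {}"
  obtains y where "y \<in> Range R" "\<And>z. R\<inverse> `` {z} \<subseteq> R\<inverse> `` {y}"
proof -
  have fin: "finite (R\<inverse> `` {z})" for z using assms(2) by simp
  have "finite (Range R)" "Range R \<noteq> {}" using assms finite_Range by auto
  then have "Max ((\<lambda>z. card (R\<inverse> `` {z})) ` Range R) \<in> (\<lambda>z. card (R\<inverse> `` {z})) ` Range R"
    by (intro Max_in) auto
  then obtain y where y: "y \<in> Range R"
    "Max ((\<lambda>z. card (R\<inverse> `` {z})) ` Range R) = card (R\<inverse> `` {y})" by blast
  have max: "card (R\<inverse> `` {z}) \<le> card (R\<inverse> `` {y})" if "z \<in> Range R" for z
    using that \<open>finite (Range R)\<close> unfolding y(2)[symmetric] by (intro Max_ge) auto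
  have "R\<inverse> `` {z} \<subseteq> R\<inverse> `` {y}" for z
  proof (rule ccontr)
    assume *: "\<not> ?thesis"
    then have "z \<in> Range R" by blast
    moreover have "R\<inverse> `` {y} \<subset> R\<inverse> `` {z}" using * assms(1) unfolding nested_def by blast
    ultimately show False using max psubset_card_mono[OF fin] leD by blast
  qed
  with y(1) that show ?thesis by blast
qed

lemma dsq_empty [simp]: "dsq {} = 0"
  by (simp add: dsq_def)

text \<open>Strong induction on \<open>b\<close> with \<open>a\<close> arbitrary. For a dominating
  vertex with neighbourhood \<open>C\<close>, either it is deleted and the bound is applied with
  \<open>card C\<close> in place of \<open>a\<close>, or \<open>C\<close> is so small that the two
  sides are exchanged; \<open>fillval_mono\<close> then leads back to \<open>a\<close>.\<close>

lemma dsq_le_fillval: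
  assumes "nested R" "finite X" "finite Y" "R \<subseteq> X \<times> Y" "card X \<le> a" "card Y \<le> b" "b \<le> a"
  shows "dsq R \<le> fillval a (card R)"
  using assms
proof (induction b arbitrary: R X Y a rule: less_induct)
  case (less b)
  have finR: "finite R" using less.prems by (meson finite_SigmaI finite_subset)
  show ?case
  proof (cases "R = {}")
    case False
    then obtain y where y: "y \<in> Range R" "\<And>z. R\<inverse> `` {z} \<subseteq> R\<inverse> `` {y}"
      using nested_dominating[OF less.prems(1) finR] by blast
    define C where "C = R\<inverse> `` {y}"
    define R' where "R' = R - C \<times> {y}"
    note rem = dsq_remove_dominating[OF finR _ C_def, folded R'_def]
    have dom: "\<And>z. R\<inverse> `` {z} \<subseteq> C" using y C_def by simp
    have yY: "y \<in> Y" using y(1) less.prems by auto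
    have CX: "C \<subseteq> X" using less.prems by (auto simp: C_def)
    have finC: "finite C" using CX less.prems(2) finite_subset by blast
    have c0: "card C > 0" using y(1) finC by (auto simp: C_def card_gt_0_iff)
    have cX: "card C \<le> a" using CX less.prems by (meson card_mono le_trans)
    have RCY: "R \<subseteq> C \<times> Y" using dom less.prems by blast
    then have "card R \<le> card C * card Y"
      using finC less.prems(3) by (metis card_cartesian_product card_mono finite_cartesian_product)
    also have "\<dots> \<le> card C * b" using less.prems by simp
    finally have mcb: "card R \<le> card C * b" .
    have b0: "b > 0" using yY less.prems(3,6) card_gt_0_iff by fastforce
    show ?thesis
    proof (cases "b \<le> card C + 1")
      case True
      \<comment> \<open>Without \<open>y\<close> at most \<open>b - 1 \<le> card C\<close> vertices
        remain on the right, so the smaller box meets the size condition of the induction.\<close>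
      have "R' \<subseteq> C \<times> (Y - {y})" using rem(3)[OF dom] less.prems by blast
      moreover have "card (Y - {y}) \<le> b - 1" using yY less.prems by simp
      ultimately have "dsq R' \<le> fillval (card C) (card R')"
        using True b0 less.prems(1,3) finC
        by (intro less.IH[of "b - 1" R' C "Y - {y}"]) (auto simp: R'_def C_def nested_remove)
      then have "dsq R \<le> fillval (card C) (card R)"
        using rem(1,2)[OF dom] fillval_add[OF c0] by simp
      also have "card C * b \<le> card C * (card C + 1)" using True by (intro mult_le_mono2)
      then have "fillval (card C) (card R) \<le> fillval a (card R)"
        using mcb cX c0 by (intro fillval_mono) auto
      finally show ?thesis .
    next
      case False
      \<comment> \<open>Now \<open>card C < b\<close>, so in the converse \<open>C\<close> is the
        smaller side and \<open>b\<close> bounds the larger one.\<close>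
      have "dsq (R\<inverse>) \<le> fillval b (card (R\<inverse>))"
        using False finC less.prems RCY
        by (intro less.IH[of "card C" "R\<inverse>" Y C]) (auto simp: nested_converse)
      then have "dsq R \<le> fillval b (card R)" by simp
      also have "card C * b \<le> (b + 1) * b" using False by (intro mult_le_mono1) auto
      then have "fillval b (card R) \<le> fillval a (card R)"
        using mcb b0 less.prems(7) by (intro fillval_mono) (auto simp: mult.commute)
      finally show ?thesis .
    qed
  qed simp
qed

text \<open>
  \<open>filled X R\<close> is the shape of \<open>B\<^sup>l\<close>: all non-isolated vertices of \<open>Y\<close> except possibly one are joined
  to the whole of \<open>X\<close>.
\<close>

definition filled :: "'a set \<Rightarrow> ('a \<times> 'a) set \<Rightarrow> bool" where
  "filled X R \<longleftrightarrow> (\<exists>y\<^sub>1. \<forall>y\<in>Range R. y \<noteq> y\<^sub>1 \<longrightarrow> R\<inverse> `` {y} = X)"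

text \<open>Deleting a vertex joined to all of \<open>X\<close> takes \<open>a\<close> from both
  sides of the size hypothesis, so the induction continues. If the dominating vertex misses some
  \<open>x\<^sub>1\<close>, then \<open>x\<^sub>1\<close> is isolated, and equality forces
  \<open>R\<close> to be complete between the rest of \<open>X\<close> and \<open>Y\<close>.\<close>

lemma dsq_eq_fillval_cases:
  assumes "nested R" "finite X" "finite Y" "R \<subseteq> X \<times> Y" "card X = a" "card Y = b" "b \<le> a"
    and "a * b \<le> card R + a" and "dsq R = fillval a (card R)"
  shows "filled X R \<or> (\<exists>x\<^sub>1. \<forall>x\<in>X. x \<noteq> x\<^sub>1 \<longrightarrow> R `` {x} = Y)"
  using assms
proof (induction b arbitrary: R Y)
  case 0
  then have "R = {}" by auto
  then show ?case by (simp add: filled_def)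
next
  case (Suc b)
  have finR: "finite R" using Suc.prems by (meson finite_SigmaI finite_subset)
  show ?case
  proof (cases "R = {}")
    case True
    then show ?thesis by (simp add: filled_def)
  next
    case False
    then obtain y where y: "y \<in> Range R" "\<And>z. R\<inverse> `` {z} \<subseteq> R\<inverse> `` {y}"
      using nested_dominating[OF Suc.prems(1) finR] by blast
    define C where "C = R\<inverse> `` {y}"
    have dom: "\<And>z. R\<inverse> `` {z} \<subseteq> C" using y C_def by simp
    have yY: "y \<in> Y" using y(1) Suc.prems by auto
    have CX: "C \<subseteq> X" using Suc.prems by (auto simp: C_def)
    show ?thesis
    proof (cases "C = X")
      case True
      define R' where "R' = R - C \<times> {y}"
      note rem = dsq_remove_dominating[OF finR dom C_def, folded R'_def]
      have a0: "a > 0" using Suc.prems by simp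
      have R'Y: "R' \<subseteq> X \<times> (Y - {y})" using rem(3) Suc.prems True by blast
      have cC: "card C = a" using True Suc.prems by simp
      have "filled X R' \<or> (\<exists>x\<^sub>1. \<forall>x\<in>X. x \<noteq> x\<^sub>1 \<longrightarrow> R' `` {x} = Y - {y})"
      proof (rule Suc.IH)
        show "nested R'" using Suc.prems(1) by (simp add: R'_def C_def nested_remove)
        show "card (Y - {y}) = b" using yY Suc.prems by simp
        show "a * b \<le> card R' + a" using Suc.prems(8) rem(2) cC by simp
        show "dsq R' = fillval a (card R')"
          using Suc.prems(9) rem(1,2) fillval_add[OF a0] cC by simp
      qed (use Suc.prems R'Y in auto)
      then show ?thesis
      proof
        assume "filled X R'"
        then obtain y\<^sub>1 where y1: "\<And>z. z \<in> Range R' \<Longrightarrow> z \<noteq> y\<^sub>1 \<Longrightarrow> R'\<inverse> `` {z} = X"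
          unfolding filled_def by blast
        have "R\<inverse> `` {z} = X" if z: "z \<in> Range R" "z \<noteq> y\<^sub>1" for z
        proof (cases "z = y")
          case True
          then show ?thesis using C_def \<open>C = X\<close> by simp
        next
          case False
          then have "R'\<inverse> `` {z} = R\<inverse> `` {z}" "z \<in> Range R'" using z by (auto simp: R'_def)
          then show ?thesis using y1 z by simp
        qed
        then show ?thesis unfolding filled_def by blast
      next
        assume "\<exists>x\<^sub>1. \<forall>x\<in>X. x \<noteq> x\<^sub>1 \<longrightarrow> R' `` {x} = Y - {y}"
        then obtain x\<^sub>1 where x1: "\<And>x. x \<in> X \<Longrightarrow> x \<noteq> x\<^sub>1 \<Longrightarrow> R' `` {x} = Y - {y}" by blast
        have "R `` {x} = Y" if x: "x \<in> X" "x \<noteq> x\<^sub>1" for x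
        proof -
          have "R `` {x} = insert y (R' `` {x})" using x True by (auto simp: R'_def C_def)
          then show ?thesis using x1[OF x] yY by auto
        qed
        then show ?thesis by blast
      qed
    next
      case False
      then obtain x\<^sub>1 where x1: "x\<^sub>1 \<in> X" "x\<^sub>1 \<notin> C" using CX by blast
      let ?D = "X - {x\<^sub>1}"
      have sub: "R \<subseteq> ?D \<times> Y" using dom Suc.prems(4) x1 by blast
      obtain d where d: "a = Suc d" using Suc.prems(7) by (cases a) auto
      have cD: "card ?D = d" using x1 Suc.prems d by simp
      have le: "card R \<le> d * Suc b"
        using card_mono[OF _ sub] Suc.prems cD by (simp add: card_cartesian_product)
      show ?thesis
      proof (cases "b = 0")
        case True
        then have "Y = {y}" using yY Suc.prems by (metis card_1_singletonE One_nat_def singletonD)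
        then have "z = y" if "z \<in> Range R" for z using that Suc.prems(4) by auto
        then show ?thesis unfolding filled_def by blast
      next
        case b0: False
        have ge: "Suc d * b \<le> card R" using Suc.prems(8) d by simp
        \<comment> \<open>If \<open>b = d\<close>, the size hypothesis suffices. Otherwise the bound
          already holds with side \<open>d\<close>, so \<open>fillval\<close> agrees at
          \<open>d\<close> and \<open>Suc d\<close>; each equality case of
          \<open>fillval_Suc\<close> then gives enough edges or contradicts
          \<open>ge\<close>.\<close>
        have "d * Suc b \<le> card R"
        proof (cases "b = d")
          case True
          then show ?thesis using ge by (simp add: mult.commute)
        next
          case False
          then have bd: "Suc b \<le> d" using Suc.prems(7) d by simp
          have "dsq R \<le> fillval d (card R)"
            using Suc.prems sub cD bd by (intro dsq_le_fillval[of R ?D Y d "Suc b"]) auto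
          moreover have m: "card R \<le> d * (d + 1)"
            using le bd by (meson add_increasing2 le_trans mult_le_mono2 trans_le_add1)
          ultimately have "fillval d (card R) = fillval (Suc d) (card R)"
            using fillval_Suc(1)[of d "card R"] bd Suc.prems(9) d by simp
          then consider "card R < d" | "d dvd card R" | "card R div d = d"
            using fillval_Suc(2)[OF _ m] bd by linarith
          then show ?thesis
          proof cases
            case 1
            then show ?thesis using ge b0 by (cases b) auto
          next
            case 2
            then obtain q where q: "card R = d * q" by blast
            have "d * b < d * q" using ge b0 unfolding q[symmetric] by simp
            then have "Suc b \<le> q" by simp
            then show ?thesis unfolding q by (rule mult_le_mono2)
          next
            case 3
            then have "d * d \<le> card R" by (metis div_times_less_eq_dividend)
            then show ?thesis using bd by (meson le_trans mult_le_mono2)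
          qed
        qed
        then have "R = ?D \<times> Y"
          using sub le Suc.prems cD
          by (intro card_subset_eq) (auto simp: card_cartesian_product)
        then have "\<forall>x\<in>X. x \<noteq> x\<^sub>1 \<longrightarrow> R `` {x} = Y" by auto
        then show ?thesis by blast
      qed
    qed
  qed
qed

section \<open>Edge shifting, and existence of relations with the extremal value\<close>

lemma dsq_shift_less:
  assumes fin: "finite X" "finite Y" and R: "R \<subseteq> X \<times> Y"
    and "(x', y) \<in> R" "(x, y) \<notin> R" "x \<in> X" "card (R `` {x'}) \<le> card (R `` {x})"
  defines "S \<equiv> insert (x, y) (R - {(x', y)})"
  shows "S \<subseteq> X \<times> Y" "card S = card R" "dsq R < dsq S"
proof -
  have finR: "finite R" using fin R by (meson finite_SigmaI finite_subset)
  have ne: "x \<noteq> x'" "x' \<in> X" "y \<in> Y" using assms by auto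
  show S: "S \<subseteq> X \<times> Y" using R ne \<open>x \<in> X\<close> by (auto simp: S_def)
  show "card S = card R"
    using finR card_Suc_Diff1[OF finR \<open>(x', y) \<in> R\<close>] \<open>(x, y) \<notin> R\<close>
    by (simp add: S_def del: card_Diff_insert)
  have X: "sum f X = f x + f x' + sum f (X - {x, x'})" for f :: "'a \<Rightarrow> nat"
  proof -
    have "sum f X = f x + sum f (X - {x})" using fin \<open>x \<in> X\<close> by (simp add: sum.remove)
    also have "sum f (X - {x}) = f x' + sum f (X - {x} - {x'})"
      using fin ne by (intro sum.remove) auto
    also have "X - {x} - {x'} = X - {x, x'}" by auto
    finally show ?thesis by simp
  qed
  have other: "S `` {z} = R `` {z}" if "z \<notin> {x, x'}" for z using that by (auto simp: S_def)
  have "S `` {x} = insert y (R `` {x})" using ne by (auto simp: S_def)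
  then have dx: "card (S `` {x}) = Suc (card (R `` {x}))"
    using finR \<open>(x, y) \<notin> R\<close> by simp
  have "S `` {x'} = R `` {x'} - {y}" using ne by (auto simp: S_def)
  then have dx': "Suc (card (S `` {x'})) = card (R `` {x'})"
    using card_Suc_Diff1[of "R `` {x'}" y] finR \<open>(x', y) \<in> R\<close> by simp
  \<comment> \<open>Moving an edge from \<open>x'\<close> to \<open>x\<close> changes this sum by
    \<open>2 (d(x) - d(x')) + 2 > 0\<close>, where \<open>d\<close> is the degree in
    \<open>R\<close>; the degrees on the other side do not change.\<close>
  have "(card (R `` {x}))\<^sup>2 + (card (R `` {x'}))\<^sup>2 < (card (S `` {x}))\<^sup>2 + (card (S `` {x'}))\<^sup>2"
    using \<open>card (R `` {x'}) \<le> card (R `` {x})\<close> unfolding dx dx'[symmetric]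
    by (simp add: power2_eq_square)
  moreover have "(\<Sum>z\<in>X - {x, x'}. (card (S `` {z}))\<^sup>2) = (\<Sum>z\<in>X - {x, x'}. (card (R `` {z}))\<^sup>2)"
    using other by (intro sum.cong) auto
  moreover have "card (S\<inverse> `` {z}) = card (R\<inverse> `` {z})" for z
  proof (cases "z = y")
    case True
    have "S\<inverse> `` {y} = insert x (R\<inverse> `` {y} - {x'})" by (auto simp: S_def)
    moreover have "x' \<in> R\<inverse> `` {y}" "x \<notin> R\<inverse> `` {y}" "finite (R\<inverse> `` {y})" using assms finR by auto
    ultimately show ?thesis
      using True card_Suc_Diff1[of "R\<inverse> `` {y}" x'] by (simp del: card_Diff_insert)
  next
    case False
    then have "S\<inverse> `` {z} = R\<inverse> `` {z}" by (auto simp: S_def)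
    then show ?thesis by simp
  qed
  ultimately show "dsq R < dsq S"
    unfolding dsq_superset[OF fin R] dsq_superset[OF fin S] X by simp
qed

text \<open>A violation of nestedness permits a shift in either direction between \<open>x\<close>
  and \<open>x'\<close>; shifting towards the vertex of larger degree increases
  \<open>dsq\<close>.\<close>

lemma nested_if_maximal:
  assumes fin: "finite X" "finite Y" and R: "R \<subseteq> X \<times> Y"
    and max: "\<And>S. S \<subseteq> X \<times> Y \<Longrightarrow> card S = card R \<Longrightarrow> dsq S \<le> dsq R"
  shows "nested R"
proof (rule ccontr)
  assume "\<not> nested R"
  then obtain x y x' y' where *: "(x, y) \<in> R" "(x', y') \<in> R" "(x, y') \<notin> R" "(x', y) \<notin> R"
    unfolding nested_def by blast
  have X: "x \<in> X" "x' \<in> X" using * R by auto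
  show False
  proof (cases "card (R `` {x'}) \<le> card (R `` {x})")
    case True
    show False
      using dsq_shift_less[OF fin R *(2,3) X(1) True] max leD by blast
  next
    case False
    then have "card (R `` {x}) \<le> card (R `` {x'})" by simp
    from dsq_shift_less[OF fin R *(1,4) X(2) this] show False using max leD by blast
  qed
qed

text \<open>Greedy filling: each new vertex takes \<open>a\<close> neighbours, or all remaining
  edges if fewer are left. Working inside given sets provides competitors over the vertex type of
  the theorem, whereas \<open>Bl\<close> lives on \<open>nat + nat\<close>.\<close>

lemma ex_dsq_eq_fillval:
  assumes fin: "finite X" "finite Y" and "card X = a" "a > 0" "m \<le> a * card Y"
  shows "\<exists>R. R \<subseteq> X \<times> Y \<and> card R = m \<and> dsq R = fillval a m"
  using assms(2,5)
proof (induction Y arbitrary: m rule: finite_induct)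
  case empty
  then have "m = 0" by simp
  then show ?case by (intro exI[of _ "{}"]) (simp add: fillval_def)
next
  case (insert y Y)
  obtain C where C: "C \<subseteq> X" "card C = min a m"
    using obtain_subset_with_card_n[of "min a m" X] assms(3) by auto
  obtain R where R: "R \<subseteq> X \<times> Y" "card R = m - card C" "dsq R = fillval a (card R)"
  proof -
    have "m - card C \<le> a * card Y" using insert.prems insert.hyps C(2)
      by (auto simp: min_def le_diff_conv add.commute)
    from insert.IH[OF this] show thesis using that by auto
  qed
  \<comment> \<open>This makes the new vertex \<open>y\<close> dominating: either no edges are left
    for the other vertices, or \<open>C\<close> is all of \<open>X\<close>.\<close>
  have CX: "R \<subseteq> C \<times> Y"
  proof (cases "m < a")
    case True
    then have "card R = 0" using R C by simp
    moreover have "finite R" using R fin insert.hyps by (meson finite_SigmaI finite_subset)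
    ultimately show ?thesis by simp
  next
    case False
    then have "C = X" using C fin(1) assms(3) by (intro card_subset_eq) auto
    then show ?thesis using R by simp
  qed
  define T where "T = R \<union> C \<times> {y}"
  have finT: "finite T" unfolding T_def using R C fin insert.hyps
    by (meson finite_SigmaI finite_subset finite_UnI finite.emptyI finite.insertI)
  have Ty: "C = T\<inverse> `` {y}" using R insert.hyps by (auto simp: T_def)
  have dom: "T\<inverse> `` {z} \<subseteq> C" for z using CX by (auto simp: T_def)
  have TR: "T - C \<times> {y} = R" using R insert.hyps by (auto simp: T_def)
  note rem = dsq_remove_dominating(1,2)[OF finT dom Ty, unfolded TR]
  have cT: "card T = m" using rem(2) R(2) C(2) by simp
  have "dsq T = fillval a m"
  proof (cases "m < a")
    case True
    then have "card C = m" "card R = 0" using C R by auto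
    then show ?thesis using True rem(1) R(3) by (simp add: fillval_def)
  next
    case False
    then have "card C = a" using C by simp
    moreover have "m = a + card R" using cT rem(2) calculation by simp
    ultimately show ?thesis using rem(1) R(3) fillval_add[OF assms(4)] by simp
  qed
  moreover have "T \<subseteq> X \<times> insert y Y" using R C by (auto simp: T_def)
  ultimately show ?case using cT by blast
qed

section \<open>Bipartite graphs as relations\<close>

definition graph_of :: "'a set \<Rightarrow> 'a set \<Rightarrow> ('a \<times> 'a) set \<Rightarrow> 'a ugraph" where
  "graph_of X Y R = \<lparr>verts = X \<union> Y, edges = (\<lambda>(x, y). {x, y}) ` R\<rparr>"

lemma graph_of_converse: "graph_of Y X (R\<inverse>) = graph_of X Y R"
proof -
  have "(\<lambda>(x, y). {x, y}) ` (R\<inverse>) = (\<lambda>(x, y). {x, y}) ` R"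
    by (force simp: insert_commute)
  then show ?thesis by (simp add: graph_of_def Un_commute)
qed

lemma edges_graph_of_iff:
  assumes "X \<inter> Y = {}" "R \<subseteq> X \<times> Y" "x \<in> X"
  shows "{x, y} \<in> edges (graph_of X Y R) \<longleftrightarrow> (x, y) \<in> R"
proof -
  have "(y, x) \<notin> R" using assms by blast
  moreover have "{x, y} \<in> edges (graph_of X Y R) \<longleftrightarrow> (x, y) \<in> R \<or> (y, x) \<in> R"
    by (auto simp: graph_of_def doubleton_eq_iff image_iff)
  ultimately show ?thesis by simp
qed

lemma degree_graph_of:
  assumes "X \<inter> Y = {}" "R \<subseteq> X \<times> Y" "x \<in> X"
  shows "degree (graph_of X Y R) x = card (R `` {x})"
proof -
  have "{e \<in> edges (graph_of X Y R). x \<in> e} = (\<lambda>y. {x, y}) ` (R `` {x})"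
    using assms by (fastforce simp: graph_of_def)
  moreover have "inj_on (\<lambda>y. {x, y}) (R `` {x})"
    by (rule inj_onI) (auto simp: doubleton_eq_iff)
  ultimately show ?thesis by (simp add: degree_def card_image)
qed

lemma sigma2_graph_of:
  assumes "finite X" "finite Y" "X \<inter> Y = {}" "R \<subseteq> X \<times> Y"
  shows "sigma2 (graph_of X Y R) = dsq R"
proof -
  have "degree (graph_of X Y R) y = card (R\<inverse> `` {y})" if "y \<in> Y" for y
    using degree_graph_of[of Y X "R\<inverse>" y] that assms by (auto simp: graph_of_converse)
  then have "(\<Sum>y\<in>Y. (degree (graph_of X Y R) y)\<^sup>2) = (\<Sum>y\<in>Y. (card (R\<inverse> `` {y}))\<^sup>2)"
    by (intro sum.cong) auto
  moreover have "(\<Sum>x\<in>X. (degree (graph_of X Y R) x)\<^sup>2) = (\<Sum>x\<in>X. (card (R `` {x}))\<^sup>2)"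
    using assms by (intro sum.cong) (auto simp: degree_graph_of)
  moreover have "verts (graph_of X Y R) = X \<union> Y" by (simp add: graph_of_def)
  ultimately show ?thesis
    unfolding sigma2_def dsq_superset[OF assms(1,2,4)]
    using assms(1-3) by (simp add: sum.union_disjoint)
qed

lemma card_edges_graph_of:
  assumes "X \<inter> Y = {}" "R \<subseteq> X \<times> Y"
  shows "card (edges (graph_of X Y R)) = card R"
proof -
  have "(y, x) \<notin> R" if "(x, y) \<in> R" for x y using assms that by blast
  then have "inj_on (\<lambda>(x, y). {x, y}) R"
    by (intro inj_onI) (auto simp: doubleton_eq_iff)
  then show ?thesis by (simp add: graph_of_def card_image)
qed

lemma graph_of_in_bipartite_graphs:
  assumes "finite X" "finite Y" "X \<inter> Y = {}" "R \<subseteq> X \<times> Y"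
  shows "graph_of X Y R \<in> bipartite_graphs (card X + card Y) (card R)"
proof -
  have "bipartition (graph_of X Y R) X Y"
    using assms unfolding bipartition_def graph_of_def by fastforce
  moreover have "simple_graph (graph_of X Y R)"
    using assms unfolding simple_graph_def graph_of_def by (fastforce simp: card_2_iff)
  moreover have "card (verts (graph_of X Y R)) = card X + card Y"
    using assms by (simp add: graph_of_def card_Un_disjoint)
  ultimately show ?thesis
    using card_edges_graph_of[OF assms(3,4)] unfolding bipartite_graphs_def bipartite_def by blast
qed

lemma bipartition_graph_of:
  assumes "bipartition G X Y"
  shows "G = graph_of X Y {(x, y) \<in> X \<times> Y. {x, y} \<in> edges G}"
proof -
  have "edges G = (\<lambda>(x, y). {x, y}) ` {(x, y) \<in> X \<times> Y. {x, y} \<in> edges G}"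
    using assms unfolding bipartition_def by fastforce
  moreover have "verts G = X \<union> Y" using assms by (simp add: bipartition_def)
  ultimately show ?thesis by (simp add: graph_of_def)
qed

section \<open>Isomorphism with the concrete graphs \<open>Bl\<close>\<close>

lemma bij_onto_initial_segments:
  assumes "finite A" "S \<subseteq> T" "T \<subseteq> A"
  obtains g where "bij_betw g A {..<card A}"
    "\<And>x. x \<in> A \<Longrightarrow> g x < card S \<longleftrightarrow> x \<in> S" "\<And>x. x \<in> A \<Longrightarrow> g x < card T \<longleftrightarrow> x \<in> T"
proof -
  have fin: "finite S" "finite T" using assms by (auto intro: rev_finite_subset)
  have le: "card S \<le> card T" "card T \<le> card A" using assms fin by (auto intro: card_mono)
  obtain g1 where g1: "bij_betw g1 S {..<card S}"
    using fin finite_same_card_bij[of S "{..<card S}"] by auto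
  obtain g2 where g2: "bij_betw g2 (T - S) {card S..<card T}"
    using fin finite_same_card_bij[of "T - S" "{card S..<card T}"] assms
    by (auto simp: card_Diff_subset)
  obtain g3 where g3: "bij_betw g3 (A - T) {card T..<card A}"
    using fin finite_same_card_bij[of "A - T" "{card T..<card A}"] assms
    by (auto simp: card_Diff_subset)
  define g where "g x = (if x \<in> S then g1 x else if x \<in> T then g2 x else g3 x)" for x
  have b1: "bij_betw g S {..<card S}"
    using g1 by (rule bij_betw_cong[THEN iffD1, rotated]) (simp add: g_def)
  have b2: "bij_betw g (T - S) {card S..<card T}"
    using g2 by (rule bij_betw_cong[THEN iffD1, rotated]) (simp add: g_def)
  have b3: "bij_betw g (A - T) {card T..<card A}"
    using g3 by (rule bij_betw_cong[THEN iffD1, rotated]) (use assms in \<open>auto simp: g_def\<close>)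
  have "bij_betw g (S \<union> (T - S)) ({..<card S} \<union> {card S..<card T})"
    using b1 b2 by (rule bij_betw_combine) auto
  then have "bij_betw g (S \<union> (T - S) \<union> (A - T)) ({..<card S} \<union> {card S..<card T} \<union> {card T..<card A})"
    using b3 by (rule bij_betw_combine) (use le in auto)
  moreover have "S \<union> (T - S) \<union> (A - T) = A" using assms by auto
  moreover have "{..<card S} \<union> {card S..<card T} \<union> {card T..<card A} = {..<card A}" using le by auto
  ultimately have "bij_betw g A {..<card A}" by simp
  moreover have r: "\<And>x. x \<in> S \<Longrightarrow> g x < card S" "\<And>x. x \<in> T - S \<Longrightarrow> card S \<le> g x \<and> g x < card T"
    "\<And>x. x \<in> A - T \<Longrightarrow> card T \<le> g x"
    using b1 b2 b3 unfolding bij_betw_def by auto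
  moreover have "g x < card S \<longleftrightarrow> x \<in> S" if "x \<in> A" for x
    using r(1)[of x] r(2)[of x] r(3)[of x] that le by (metis DiffI leD le_trans)
  moreover have "g x < card T \<longleftrightarrow> x \<in> T" if "x \<in> A" for x
    using r(1)[of x] r(2)[of x] r(3)[of x] that le assms(2) by (metis DiffI leD less_le_trans)
  ultimately show thesis using that by blast
qed

text \<open>The relation splits into full vertices \<open>F\<close> and one vertex with
  neighbourhood \<open>N\<close> properly inside \<open>X\<close>; uniqueness of division with
  remainder identifies their cardinalities with the quotient and remainder in
  \<open>Bl\<close>.\<close>

lemma filled_iso_Bl:
  assumes fin: "finite X" "finite Y" and disj: "X \<inter> Y = {}" and R: "R \<subseteq> X \<times> Y"
    and "filled X R" "card X > 0" "n = card X + card Y"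
  shows "graph_of X Y R \<simeq> Bl n (card R) (card X)"
proof -
  obtain y\<^sub>1 where y1: "\<And>y. y \<in> Range R \<Longrightarrow> y \<noteq> y\<^sub>1 \<Longrightarrow> R\<inverse> `` {y} = X"
    using assms(5) unfolding filled_def by blast
  define F where "F = {y \<in> Y. R\<inverse> `` {y} = X}"
  \<comment> \<open>The exceptional vertex may itself be full; then \<open>N\<close> is empty, which
    secures \<open>N \<noteq> X\<close>.\<close>
  define N where "N = (if y\<^sub>1 \<in> F then {} else R\<inverse> `` {y\<^sub>1})"
  have NX: "N \<subseteq> X" using R by (auto simp: N_def)
  have Req: "R = X \<times> F \<union> N \<times> {y\<^sub>1}"
  proof (intro equalityI subsetI)
    fix p assume p: "p \<in> R"
    then obtain x y where xy: "p = (x, y)" "(x, y) \<in> R" "x \<in> X" "y \<in> Y" using R by auto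
    show "p \<in> X \<times> F \<union> N \<times> {y\<^sub>1}"
      using y1[of y] xy by (cases "y = y\<^sub>1") (auto simp: F_def N_def)
  next
    fix p assume "p \<in> X \<times> F \<union> N \<times> {y\<^sub>1}"
    then show "p \<in> R" by (auto simp: F_def N_def split: if_splits)
  qed
  have NeX: "N \<noteq> X"
  proof
    assume "N = X"
    then have "R\<inverse> `` {y\<^sub>1} = X" "y\<^sub>1 \<notin> F" "X \<noteq> {}"
      using \<open>card X > 0\<close> by (auto simp: N_def split: if_splits)
    moreover from this have "y\<^sub>1 \<in> Y" using R by blast
    ultimately show False by (simp add: F_def)
  qed
  have finN: "finite N" "finite F" using NX fin finite_subset by (auto simp: F_def)
  have Nlt: "card N < card X" using NX NeX fin by (simp add: psubset_card_mono psubsetI)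
  have "X \<times> F \<inter> N \<times> {y\<^sub>1} = {}" by (auto simp: N_def)
  then have "card R = card X * card F + card N"
    unfolding Req using fin finN by (simp add: card_Un_disjoint card_cartesian_product)
  then have q: "card R div card X = card F" and r: "card R mod card X = card N"
    using Nlt by auto
  \<comment> \<open>If \<open>N\<close> is empty, \<open>y\<^sub>1\<close> might not even belong to
    \<open>Y\<close>. Otherwise numbering \<open>F\<close> first and \<open>T\<close> next gives
    \<open>y\<^sub>1\<close> the index \<open>card F\<close>.\<close>
  define T where "T = (if N = {} then F else insert y\<^sub>1 F)"
  have TY: "F \<subseteq> T" "T \<subseteq> Y"
    using R by (auto simp: T_def F_def N_def)
  obtain gX where gX: "bij_betw gX X {..<card X}" "\<And>x. x \<in> X \<Longrightarrow> gX x < card N \<longleftrightarrow> x \<in> N"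
    using bij_onto_initial_segments[OF fin(1) NX order_refl] by metis
  obtain gY where gY: "bij_betw gY Y {..<card Y}"
    "\<And>y. y \<in> Y \<Longrightarrow> gY y < card F \<longleftrightarrow> y \<in> F" "\<And>y. y \<in> Y \<Longrightarrow> gY y < card T \<longleftrightarrow> y \<in> T"
    using bij_onto_initial_segments[OF fin(2) TY] by metis
  have mem: "(x, y) \<in> R \<longleftrightarrow> gY y < card F \<or> gY y = card F \<and> gX x < card N"
    if "x \<in> X" "y \<in> Y" for x y
  proof (cases "x \<in> N")
    case False
    then show ?thesis using that gX(2) gY(2) unfolding Req by auto
  next
    case True
    then have "y\<^sub>1 \<notin> F" "T = insert y\<^sub>1 F" by (auto simp: N_def T_def split: if_splits)
    then have "card T = Suc (card F)" using finN by simp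
    then have "gY y = card F \<longleftrightarrow> y \<in> T \<and> y \<notin> F" using gY(2,3) that by (metis less_Suc_eq less_irrefl)
    then show ?thesis
      using that True gX(2) gY(2) \<open>y\<^sub>1 \<notin> F\<close> \<open>T = insert y\<^sub>1 F\<close> unfolding Req by auto
  qed
  define f where "f z = (if z \<in> X then Inl (gX z) else Inr (gY z) :: nat + nat)" for z
  have "bij_betw f X (Inl ` {..<card X})"
  proof -
    have "bij_betw (Inl \<circ> gX) X (Inl ` {..<card X} :: (nat + nat) set)"
      using gX(1) by (rule bij_betw_trans) (simp add: bij_betw_def)
    then show ?thesis by (rule bij_betw_cong[THEN iffD1, rotated]) (simp add: f_def)
  qed
  moreover have "bij_betw f Y (Inr ` {..<card Y})"
  proof -
    have "bij_betw (Inr \<circ> gY) Y (Inr ` {..<card Y} :: (nat + nat) set)"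
      using gY(1) by (rule bij_betw_trans) (simp add: bij_betw_def)
    then show ?thesis
      by (rule bij_betw_cong[THEN iffD1, rotated]) (use disj in \<open>auto simp: f_def\<close>)
  qed
  ultimately have bij: "bij_betw f (X \<union> Y) (Inl ` {..<card X} \<union> Inr ` {..<card Y})"
    by (rule bij_betw_combine) auto
  let ?E = "edges (Bl n (card R) (card X))"
  have E: "?E = {{Inl i, Inr j} | i j. i < card X \<and> j < card Y \<and> (j < card F \<or> j = card F \<and> i < card N)}"
    unfolding Bl_def Let_def q r using assms(7) by simp
  have rng: "\<And>x. x \<in> X \<Longrightarrow> gX x < card X" "\<And>y. y \<in> Y \<Longrightarrow> gY y < card Y"
    using gX(1) gY(1) unfolding bij_betw_def by auto
  have XY: "{f x, f y} \<in> ?E \<longleftrightarrow> {x, y} \<in> edges (graph_of X Y R)" if "x \<in> X" "y \<in> Y" for x y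
  proof -
    have "y \<notin> X" using that disj by auto
    then have "{f x, f y} = {Inl (gX x), Inr (gY y)}" using that by (simp add: f_def)
    then have "{f x, f y} \<in> ?E \<longleftrightarrow> gY y < card F \<or> gY y = card F \<and> gX x < card N"
      unfolding E using rng that by (auto simp: doubleton_eq_iff)
    then show ?thesis using mem[OF that] edges_graph_of_iff[OF disj R that(1)] by simp
  qed
  have "{u, v} \<in> edges (graph_of X Y R) \<longleftrightarrow> {f u, f v} \<in> ?E" 
    if uv: "u \<in> X \<union> Y" "v \<in> X \<union> Y" for u v
  proof -
    consider "u \<in> X" "v \<in> X" | "u \<in> X" "v \<in> Y" | "u \<in> Y" "v \<in> X" | "u \<in> Y" "v \<in> Y"
      using uv by blast
    then show ?thesis
    proof cases
      case 1
      then have "{f u, f v} \<notin> ?E" unfolding E by (auto simp: f_def doubleton_eq_iff)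
      moreover have "(u, v) \<notin> R" using 1 R disj by auto
      ultimately show ?thesis using 1 edges_graph_of_iff[OF disj R] by blast
    next
      case 2
      then show ?thesis using XY by blast
    next
      case 3
      then show ?thesis using XY[of v u] by (simp add: insert_commute)
    next
      case 4
      then have "u \<notin> X" "v \<notin> X" using disj by auto
      then have "{f u, f v} \<notin> ?E" unfolding E by (auto simp: f_def doubleton_eq_iff)
      moreover have "{u, v} \<notin> edges (graph_of X Y R)"
        using \<open>u \<notin> X\<close> \<open>v \<notin> X\<close> R by (force simp: graph_of_def doubleton_eq_iff)
      ultimately show ?thesis by blast
    qed
  qed
  moreover have "verts (Bl n (card R) (card X)) = Inl ` {..<card X} \<union> Inr ` {..<card Y}"
    using assms(7) by (simp add: Bl_def Let_def)
  moreover have "verts (graph_of X Y R) = X \<union> Y" by (simp add: graph_of_def)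
  ultimately show ?thesis unfolding graph_iso_def using bij by metis
qed

section \<open>The parameter \<open>k\<^sub>0\<close> and the theorem\<close>

text \<open>The quotient plus the sign of the remainder is \<open>m / k\<close> rounded up, so the
  condition says that parts of sizes \<open>k\<close> and \<open>n - k\<close> have room for
  \<open>m\<close> edges.\<close>

lemma k0_condition_iff:
  assumes "k > 0"
  shows "int k \<le> int n - int (m div k) - sgn (int (m mod k)) \<longleftrightarrow> k \<le> n \<and> m \<le> k * (n - k)"
proof -
  define q r where "q = m div k" and "r = m mod k"
  have m: "m = k * q + r" and r: "r < k" using assms by (auto simp: q_def r_def)
  have "int k \<le> int n - int q - sgn (int r) \<longleftrightarrow> k \<le> n \<and> q + (if r = 0 then 0 else 1) \<le> n - k"
    by (auto simp: sgn_if)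
  also have "q + (if r = 0 then 0 else 1) \<le> n - k \<longleftrightarrow> m \<le> k * (n - k)"
  proof (cases "r = 0")
    case True
    then show ?thesis using assms m by simp
  next
    case False
    have "k * Suc q \<le> k * (n - k)" if "Suc q \<le> n - k" using that by (rule mult_le_mono2)
    moreover have "k * (n - k) \<le> k * q" if "n - k \<le> q" using that by (rule mult_le_mono2)
    ultimately have "Suc q \<le> n - k \<longleftrightarrow> m \<le> k * (n - k)"
      using False m r by (cases "Suc q \<le> n - k") (simp, linarith)
    then show ?thesis using False by simp
  qed
  finally show ?thesis unfolding q_def r_def .
qed

lemma k0_props:
  assumes "n \<ge> 2" "m \<le> n div 2 * ((n + 1) div 2)"
  shows "(n + 1) div 2 \<le> k0 n m" "k0 n m \<le> n" "m \<le> k0 n m * (n - k0 n m)"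
    and "\<And>k. (n + 1) div 2 \<le> k \<Longrightarrow> k \<le> n \<Longrightarrow> m \<le> k * (n - k) \<Longrightarrow> k \<le> k0 n m"
proof -
  note K = k0_set[OF assms]
  note in_K = Max_in[OF K(1), folded k0_def]
  show ge: "(n + 1) div 2 \<le> k0 n m" using in_K K(2) by blast
  then have "k0 n m > 0" using assms(1) by simp
  then show "k0 n m \<le> n" "m \<le> k0 n m * (n - k0 n m)"
    using in_K K(2) k0_condition_iff by blast+
  fix k assume k: "(n + 1) div 2 \<le> k" "k \<le> n" "m \<le> k * (n - k)"
  then have "k > 0" using assms(1) by simp
  then show "k \<le> k0 n m"
    unfolding k0_def using k k0_condition_iff by (intro Max_ge[OF K(1)]) blast
qed

lemma column_filled:
  assumes fin: "finite X" "finite Y" and R: "R \<subseteq> X \<times> Y"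
    and x\<^sub>1: "\<forall>x\<in>X. x \<noteq> x\<^sub>1 \<longrightarrow> R `` {x} = Y"
  shows "filled Y (R\<inverse>)" "(card X - 1) * card Y \<le> card R"
proof -
  have "(R\<inverse>)\<inverse> `` {x} = Y" if "x \<in> Range (R\<inverse>)" "x \<noteq> x\<^sub>1" for x
    using that R x\<^sub>1 by auto
  then show "filled Y (R\<inverse>)" unfolding filled_def by blast
  have "(X - {x\<^sub>1}) \<times> Y \<subseteq> R" using x\<^sub>1 by auto
  moreover have "finite R" using fin R by (meson finite_SigmaI finite_subset)
  ultimately have "card (X - {x\<^sub>1}) * card Y \<le> card R"
    by (metis card_cartesian_product card_mono)
  moreover have "card X - 1 \<le> card (X - {x\<^sub>1})" using fin by (simp add: card_Diff_singleton_if)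
  ultimately show "(card X - 1) * card Y \<le> card R" by (meson le_trans mult_le_mono1)
qed

text \<open>In the transposed alternative all but one vertex of \<open>X\<close> see all of
  \<open>Y\<close>. The resulting lower bound on \<open>card R\<close> later excludes
  \<open>B\<^sup>l(n,m,n-k\<^sub>0)\<close> in part (c).\<close>

lemma graph_of_iso_Bl_cases:
  assumes fin: "finite X" "finite Y" and disj: "X \<inter> Y = {}" and R: "R \<subseteq> X \<times> Y"
    and "nested R" "0 < card Y" "card Y \<le> card X" "card X * card Y \<le> card R + card X"
    and "dsq R = fillval (card X) (card R)" and n: "n = card X + card Y"
  shows "graph_of X Y R \<simeq> Bl n (card R) (card X) \<or>
    (graph_of X Y R \<simeq> Bl n (card R) (card Y) \<and> (card X - 1) * card Y \<le> card R)"
proof -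
  have "filled X R \<or> (\<exists>x\<^sub>1. \<forall>x\<in>X. x \<noteq> x\<^sub>1 \<longrightarrow> R `` {x} = Y)"
    using assms by (intro dsq_eq_fillval_cases) auto
  then show ?thesis
  proof
    assume "filled X R"
    then show ?thesis using filled_iso_Bl[OF fin disj R _ _ n] assms(6,7) by simp
  next
    assume "\<exists>x\<^sub>1. \<forall>x\<in>X. x \<noteq> x\<^sub>1 \<longrightarrow> R `` {x} = Y"
    then obtain x\<^sub>1 where "\<forall>x\<in>X. x \<noteq> x\<^sub>1 \<longrightarrow> R `` {x} = Y" by blast
    note col = column_filled[OF fin R this]
    have "graph_of Y X (R\<inverse>) \<simeq> Bl n (card (R\<inverse>)) (card Y)"
      using fin disj R col(1) assms(6) n by (intro filled_iso_Bl) auto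
    then show ?thesis using col(2) by (simp add: graph_of_converse)
  qed
qed

theorem theorem2:
  fixes n m :: nat and B :: "'a ugraph"
  assumes "n \<ge> 2"
    and "n \<le> m"
    and "m \<le> n div 2 * ((n + 1) div 2)"
    and "B \<in> bipartite_graphs n m"
    and "\<forall>H \<in> (bipartite_graphs n m :: 'a ugraph set). sigma2 H \<le> sigma2 B"
  shows "(m > (n - k0 n m) * (k0 n m - 1) \<longrightarrow>
            B \<simeq> Bl n m (k0 n m) \<or> B \<simeq> Bl n m (n - k0 n m)) \<and>
         (m = (n - k0 n m) * (k0 n m - 1) \<longrightarrow>
            B \<simeq> Bl n m (k0 n m) \<or> B \<simeq> Bl n m (n - k0 n m) \<or> B \<simeq> Bl n m (k0 n m - 1)) \<and>
         (m < (n - k0 n m) * (k0 n m - 1) \<longrightarrow>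
            B \<simeq> Bl n m (k0 n m))"
proof -
  define k where "k = k0 n m"
  note kp = k0_props[OF assms(1,3), folded k_def]
  obtain X0 Y0 where XY0: "bipartition B X0 Y0"
    using assms(4) unfolding bipartite_graphs_def bipartite_def by blast
  have "bipartition B Y0 X0"
    using XY0 unfolding bipartition_def by (metis Un_commute Int_commute insert_commute)
  then obtain X Y where XY: "bipartition B X Y" and yx: "card Y \<le> card X"
    using XY0 nat_le_linear by metis
  define R where "R = {(x, y) \<in> X \<times> Y. {x, y} \<in> edges B}"
  have B: "B = graph_of X Y R" using bipartition_graph_of[OF XY] by (simp add: R_def)
  have V: "verts B = X \<union> Y" and disj: "X \<inter> Y = {}" using XY by (auto simp: bipartition_def)
  have finV: "finite (verts B)" and cV: "card (verts B) = n" and cE: "card (edges B) = m"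
    using assms(4) by (auto simp: bipartite_graphs_def simple_graph_def)
  have fin: "finite X" "finite Y" using finV V by auto
  have n: "n = card X + card Y" using cV V fin disj by (simp add: card_Un_disjoint)
  have R: "R \<subseteq> X \<times> Y" by (auto simp: R_def)
  have m: "card R = m" using card_edges_graph_of[OF disj R] B cE by simp
  \<comment> \<open>The parts may have any sizes adding up to \<open>n\<close>, so \<open>R\<close>
    also competes with other bipartitions.\<close>
  have max: "dsq S \<le> dsq R"
    if "finite X'" "finite Y'" "X' \<inter> Y' = {}" "S \<subseteq> X' \<times> Y'" "card X' + card Y' = n" "card S = m"
    for X' Y' :: "'a set" and S
  proof -
    have "graph_of X' Y' S \<in> bipartite_graphs n m"
      using graph_of_in_bipartite_graphs[OF that(1-4)] that(5,6) by simp
    then have "sigma2 (graph_of X' Y' S) \<le> sigma2 B" using assms(5) by blast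
    then show ?thesis using sigma2_graph_of[OF that(1-4)] sigma2_graph_of[OF fin disj R] B by simp
  qed
  have nest: "nested R" using max fin disj n m by (intro nested_if_maximal[OF fin R]) auto
  have m0: "m > 0" using assms by simp
  have "card R \<le> card X * card Y"
    using card_mono[OF _ R] fin by (simp add: card_cartesian_product)
  then have mxy: "m \<le> card X * card Y" using m by simp
  have xk: "card X \<le> k" using kp(4)[of "card X"] n yx mxy by simp
  have x0: "card X > 0" and y0: "card Y > 0" using mxy m0 by (auto intro: gr0I)
  have kn: "k < n" using kp(2,3) m0 by (cases "k = n") auto
  have kmax: "(k + 1) * (n - k - 1) < m"
  proof (rule ccontr)
    assume "\<not> ?thesis"
    then have "k + 1 \<le> k" using kp(1,2) kn by (intro kp(4)) auto
    then show False by simp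
  qed
  have ge: "fillval k m \<le> dsq R"
  proof -
    obtain X' where X': "X' \<subseteq> verts B" "card X' = k"
      using obtain_subset_with_card_n[of k "verts B"] cV kp(2) by auto
    have c': "card (verts B - X') = n - k"
      using X' finV cV by (simp add: card_Diff_subset finite_subset)
    have fX': "finite X'" using X' finV finite_subset by blast
    obtain S where "S \<subseteq> X' \<times> (verts B - X')" "card S = m" "dsq S = fillval k m"
      using ex_dsq_eq_fillval[of X' "verts B - X'" k m] X' fX' finV c' kp(3) x0 xk by auto
    then show ?thesis using max[of X' "verts B - X'" S] fX' finV X'(2) c' kn by auto
  qed
  \<comment> \<open>Upper bound, monotonicity and \<open>ge\<close> close up, so
    \<open>fillval\<close> is constant in its first argument from \<open>card X\<close> to
    \<open>k\<close>.\<close>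
  have eq: "dsq R = fillval a m" if a: "card X \<le> a" "a \<le> k" for a
  proof -
    have "dsq R \<le> fillval a m"
      using dsq_le_fillval[OF nest fin R a(1) order_refl] yx a m by simp
    moreover have "card X * card Y \<le> a * (a + 1)" using a yx by (intro mult_le_mono) auto
    then have "fillval a m \<le> fillval k m" using mxy a x0 by (intro fillval_mono) auto
    ultimately show ?thesis using ge by simp
  qed
  \<comment> \<open>With these side conditions on \<open>m\<close>, the three parts of the theorem
    follow by propositional reasoning.\<close>
  have "B \<simeq> Bl n m k \<or> B \<simeq> Bl n m (n - k) \<and> (n - k) * (k - 1) \<le> m \<or>
    B \<simeq> Bl n m (k - 1) \<and> m = (n - k) * (k - 1)"
  proof (cases "card X = k")
    case True
    obtain z where z: "card Y = Suc z" using y0 by (cases "card Y") auto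
    have "card X * card Y \<le> m + card X" using kmax True n z by simp
    then show ?thesis
      using graph_of_iso_Bl_cases[OF fin disj R nest y0 yx _ _ n] eq[of k] True n m
      unfolding B[symmetric] by (auto simp: mult.commute)
  next
    case False
    then obtain a where a: "k = Suc a" "card X \<le> a" using xk by (cases k) auto
    obtain z where z: "n - k = Suc z" using kn by (metis Suc_diff_Suc)
    \<comment> \<open>\<open>card Y\<close> is at most \<open>card X \<le> a\<close>, and at least
      \<open>n - a = z + 2\<close>.\<close>
    have za: "Suc (Suc z) \<le> a" using z a n yx by linarith
    have mz: "m \<le> a * z + a + z + 1" using kp(3) a z by simp
    have "k + 1 = a + 2" "n - k - 1 = z" using a(1) z by linarith+
    then have "(a + 2) * z < m" using kmax by metis
    then have mz': "a * z + 2 * z < m" by (simp add: algebra_simps)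
    have ma: "m \<le> a * (a + 1)"
      using mxy a(2) yx by (meson le_trans mult_le_mono trans_le_add1)
    have "fillval a m = fillval (Suc a) m" using eq[of a] eq[of k] a xk by simp
    then consider "m < a" | "a dvd m" | "m div a = a" using fillval_Suc(2)[OF _ ma] za by linarith
    \<comment> \<open>By \<open>mz'\<close> and \<open>mz\<close>, \<open>m\<close> exceeds
      \<open>a z\<close> but stays below \<open>a (z + 2)\<close>, so \<open>a (z + 1)\<close> is
      the only multiple of \<open>a\<close> available; the other equality cases violate
      \<open>n \<le> m\<close> or \<open>mz\<close>.\<close>
    then have m_eq: "m = a * Suc z"
    proof cases
      case 1
      then show ?thesis using assms(2) kn a by simp
    next
      case 2
      then obtain q where q: "m = a * q" by blast
      have "\<not> q \<le> z"
      proof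
        assume "q \<le> z"
        then have "a * q \<le> a * z" by (rule mult_le_mono2)
        then show False using mz' q by linarith
      qed
      moreover have "\<not> Suc (Suc z) \<le> q"
      proof
        assume "Suc (Suc z) \<le> q"
        then have "a * Suc (Suc z) \<le> a * q" by (rule mult_le_mono2)
        moreover have "a * Suc (Suc z) = a * z + 2 * a" by simp
        ultimately show False using mz q za by linarith
      qed
      ultimately have "q = Suc z" by linarith
      then show ?thesis using q by simp
    next
      case 3
      then have "a * a \<le> m" by (metis div_times_less_eq_dividend)
      moreover have "a * Suc (Suc z) \<le> a * a" using za by (rule mult_le_mono2)
      moreover have "a * Suc (Suc z) = a * z + 2 * a" by simp
      ultimately have False using mz za by linarith
      then show ?thesis ..
    qed
    \<comment> \<open>A still smaller \<open>X\<close> would give a second equality, between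
      \<open>d = a - 1\<close> and \<open>a\<close>; with \<open>m = (d + 1) (z + 1)\<close> and
      \<open>z + 3 \<le> d\<close> all its cases fail.\<close>
    have "card X = a"
    proof (rule ccontr)
      assume "card X \<noteq> a"
      then obtain d where d: "a = Suc d" "card X \<le> d" using a by (cases a) auto
      have zd: "z + 3 \<le> d" using z a d n yx by linarith
      have md: "m \<le> d * (d + 1)"
        using mxy d(2) yx by (meson le_trans mult_le_mono trans_le_add1)
      have "fillval d m = fillval (Suc d) m" using eq[of d] eq[of a] a d by simp
      then consider "m < d" | "d dvd m" | "m div d = d" using fillval_Suc(2)[OF _ md] zd by linarith
      then show False
      proof cases
        case 1
        then show False using m_eq d by simp
      next
        case 2
        then have "d dvd d * Suc z + Suc z" using m_eq d by (simp add: algebra_simps)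
        then have "d dvd Suc z" by (metis dvd_add_right_iff dvd_triv_left)
        then show False using zd by (auto dest: dvd_imp_le)
      next
        case 3
        then have "d * d \<le> m" by (metis div_times_less_eq_dividend)
        moreover have "d * (z + 3) \<le> d * d" using zd by (rule mult_le_mono2)
        moreover have "d * (z + 3) = d * z + 3 * d" "m = d * z + d + z + 1"
          using m_eq d by (auto simp: algebra_simps)
        ultimately show False using zd by linarith
      qed
    qed
    moreover from this have y: "card Y = Suc (Suc z)" using n z a by linarith
    ultimately have "B \<simeq> Bl n m a \<or> (B \<simeq> Bl n m (Suc (Suc z)) \<and> (a - 1) * Suc (Suc z) \<le> m)"
      using graph_of_iso_Bl_cases[OF fin disj R nest y0 yx _ _ n] eq[of a] a m m_eq
      unfolding B[symmetric] by auto
    \<comment> \<open>The transposed alternative thus occurs only for parts of equal size, where it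
      names the same graph \<open>Bl n m a\<close>.\<close>
    moreover have "a = Suc (Suc z)" if "(a - 1) * Suc (Suc z) \<le> m"
      using that za m_eq by (cases a) auto
    ultimately show ?thesis using a z m_eq by auto
  qed
  then show ?thesis unfolding k_def by auto
qed

end
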